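(* Let $X,Y$ be Banach spaces, $D\subset X$ a nonempty open convex set, and $F:D\to Y$ a twice continuously (Fréchet) differentiable operator. Assume that there is $x_0\in D$ such that $F'(x_0)^{-1}$ exists and that, for some $R>0$, $h:[0,R)\to\mathbb{R}$ is a majorizing function to $F$ at $x_0$. Let $t^*$ be the smallest zero of $h$ in $(0,R)$. Let $\{x_k\}$ be the Halley sequence for $F$ started at $x_0$, let $x^*$ be its limit, and let $\{t_k\}$ be the Halley sequence for $h$ started at $t_0=0$ (both defined in the context). Then $$\|x^*-x_{k+1}\|\le(t^*-t_{k+1})\left(\frac{\|x^*-x_k\|}{t^*-t_k}\right)^3,\quad k=0,1,\ldots.$$ Consequently $\{x_k\}$ converges Q-cubically, with $$\|x^*-x_{k+1}\|\le\left[\frac13\frac{h''(t^* )^2}{h'(t^* )^2}+\frac29\frac{D^-h''(t^* )}{-h'(t^* )}\right]\|x^*-x_k\|^3,\quad k=0,1,\ldots.$$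
   Context: $B(x,r)$ is the open ball with center $x$ and radius $r$. $I$ is the identity operator. $L_F(x)=\frac12F'(x)^{-1}F''(x)F'(x)^{-1}F(x)$, i.e. the bounded linear operator $v\mapsto\frac12F'(x)^{-1}F''(x)\big(F'(x)^{-1}F(x),v\big)$ on $X$. Majorizing function: let $R>0$ and $F'(x_0)$ be nonsingular (boundedly invertible). A twice continuously differentiable $h:[0,R)\to\mathbb{R}$ is a majorizing function to $F$ at $x_0$ if $B(x_0,R)\subset D$ and all of the following hold: (1) $\|F'(x_0)^{-1}[F''(y)-F''(x)]\|\le h''(\|y-x\|+\|x-x_0\|)-h''(\|x-x_0\|)$ for all $x,y\in B(x_0,R)$ with $\|y-x\|+\|x-x_0\|<R$; (2) $\|F'(x_0)^{-1}F(x_0)\|\le h(0)$ and $\|F'(x_0)^{-1}F''(x_0)\|\le h''(0)$; (3) $h(0)>0$, $h''(0)>0$, $h'(0)=-1$; (4) $h''$ is convex and strictly increasing on $[0,R)$; (5) $h$ has a zero in $(0,R)$ and, denoting by $t^*$ its smallest zero, $h'(t^* )<0$. Halley sequence for $F$: $x_{k+1}=x_k-[I-L_F(x_k)]^{-1}F'(x_k)^{-1}F(x_k)$, $k\ge0$; under the stated hypotheses it is well defined, contained in $B(x_0,t^* )$, and converges to a point $x^*\in\overline{B(x_0,t^* )}$ with $F(x^* )=0$. Halley sequence for $h$: $t_0=0$, $t_{k+1}=t_k-\frac{1}{1-L_h(t_k)}\cdot\frac{h(t_k)}{h'(t_k)}$, where $L_h(t)=\frac{h(t)h''(t)}{2h'(t)^2}$;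 it is well defined, strictly increasing, contained in $[0,t^* )$ and converges to $t^*$. For a convex function $g$ on an interval and an interior point $u_0$, $D^-g(u_0)=\lim_{u\to u_0^-}\frac{g(u_0)-g(u)}{u_0-u}$. A sequence $x_n\to x^*$ converges Q-cubically if there are constants $c\ge0$, $N\ge0$ with $\|x^*-x_{n+1}\|\le c\|x^*-x_n\|^3$ for all $n\ge N$. *)

theory Defs
  imports "HOL-Analysis.Analysis"
begin

definition boundedly_invertible ::
    "('a::real_normed_vector \<Rightarrow>\<^sub>L 'b::real_normed_vector) \<Rightarrow> bool" where
  "boundedly_invertible A \<longleftrightarrow> bij (blinfun_apply A) \<and> bounded_linear (inv (blinfun_apply A))"

text \<open>Only meaningful for boundedly invertible arguments.\<close>

definition inv_blinfun ::
    "('a::real_normed_vector \<Rightarrow>\<^sub>L 'b::real_normed_vector) \<Rightarrow> ('b \<Rightarrow>\<^sub>L 'a)" where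
  "inv_blinfun A = Blinfun (inv (blinfun_apply A))"

lemma inv_blinfun_compose:
  assumes "boundedly_invertible A"
  shows "inv_blinfun A o\<^sub>L A = id_blinfun" "A o\<^sub>L inv_blinfun A = id_blinfun"
proof -
  have inj: "inj (blinfun_apply A)" and surj: "surj (blinfun_apply A)"
    and bl: "bounded_linear (inv (blinfun_apply A))"
    using assms by (auto simp: boundedly_invertible_def bij_def)
  show "inv_blinfun A o\<^sub>L A = id_blinfun"
    by (rule blinfun_eqI) (simp add: inv_blinfun_def bounded_linear_Blinfun_apply[OF bl] inj)
  show "A o\<^sub>L inv_blinfun A = id_blinfun"
    by (rule blinfun_eqI)
      (simp add: inv_blinfun_def bounded_linear_Blinfun_apply[OF bl] surj_f_inv_f[OF surj])
qed

lemma inv_blinfun_unique: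
  assumes "B o\<^sub>L A = id_blinfun" "A o\<^sub>L B = id_blinfun"
  shows "boundedly_invertible A" "inv_blinfun A = B"
proof -
  have BA: "blinfun_apply B (blinfun_apply A x) = x" for x
    using assms(1) by (metis blinfun_apply_blinfun_compose blinfun_apply_id_blinfun)
  have AB: "blinfun_apply A (blinfun_apply B y) = y" for y
    using assms(2) by (metis blinfun_apply_blinfun_compose blinfun_apply_id_blinfun)
  have bij: "bij (blinfun_apply A)"
    by (rule bijI') (metis BA, metis AB)
  have inv: "inv (blinfun_apply A) = blinfun_apply B"
    by (rule inv_equality) (simp_all add: BA AB)
  show "boundedly_invertible A"
    using bij by (simp add: boundedly_invertible_def inv blinfun.bounded_linear_right)
  show "inv_blinfun A = B"
    by (simp add: inv_blinfun_def inv blinfun_apply_inverse)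
qed

text \<open>
  A bounded bilinear map \<open>X \<times> X \<rightarrow> Y\<close> is represented as a bounded operator from \<open>X\<close> into the
  bounded operators \<open>X \<rightarrow> Y\<close>; the nested operator norm is the usual norm of bilinear maps.
  The following is the bilinear map \<open>(u, v) \<mapsto> A (T u v)\<close>.
\<close>

definition compose_bilinear ::
    "('b::real_normed_vector \<Rightarrow>\<^sub>L 'c::real_normed_vector) \<Rightarrow>
     ('a::real_normed_vector \<Rightarrow>\<^sub>L 'a \<Rightarrow>\<^sub>L 'b) \<Rightarrow> ('a \<Rightarrow>\<^sub>L 'a \<Rightarrow>\<^sub>L 'c)" where
  "compose_bilinear A T = Blinfun (\<lambda>u. A o\<^sub>L blinfun_apply T u)"

lemma compose_bilinear_apply:
  "blinfun_apply (blinfun_apply (compose_bilinear A T) u) v =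
     blinfun_apply A (blinfun_apply (blinfun_apply T u) v)"
proof -
  have "bounded_linear (\<lambda>u. A o\<^sub>L blinfun_apply T u)"
    by (intro bounded_linear_compose[OF bounded_bilinear.bounded_linear_right
          [OF bounded_bilinear_blinfun_compose]] blinfun.bounded_linear_right)
  then show ?thesis
    by (simp add: compose_bilinear_def bounded_linear_Blinfun_apply)
qed

text \<open>\<open>F'\<close> and \<open>F''\<close> are the first two Frechet derivatives of \<open>F\<close> on the open set \<open>D\<close>.\<close>

definition twice_cont_frechet_diff_on ::
    "'a::real_normed_vector set \<Rightarrow> ('a \<Rightarrow> 'b::real_normed_vector) \<Rightarrow>
     ('a \<Rightarrow> 'a \<Rightarrow>\<^sub>L 'b) \<Rightarrow> ('a \<Rightarrow> 'a \<Rightarrow>\<^sub>L 'a \<Rightarrow>\<^sub>L 'b) \<Rightarrow> bool" where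
  "twice_cont_frechet_diff_on D F F' F'' \<longleftrightarrow>
     (\<forall>x\<in>D. (F has_derivative blinfun_apply (F' x)) (at x)) \<and>
     (\<forall>x\<in>D. (F' has_derivative blinfun_apply (F'' x)) (at x)) \<and>
     continuous_on D F''"

text \<open>On an interval \<open>S\<close>, derivatives at endpoints belonging to \<open>S\<close> are one-sided.\<close>

definition twice_cont_real_diff_on ::
    "real set \<Rightarrow> (real \<Rightarrow> real) \<Rightarrow> (real \<Rightarrow> real) \<Rightarrow> (real \<Rightarrow> real) \<Rightarrow> bool" where
  "twice_cont_real_diff_on S h h' h'' \<longleftrightarrow>
     (\<forall>t\<in>S. (h has_real_derivative h' t) (at t within S)) \<and>
     (\<forall>t\<in>S. (h' has_real_derivative h'' t) (at t within S)) \<and>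
     continuous_on S h''"

definition smallest_zero :: "(real \<Rightarrow> real) \<Rightarrow> real \<Rightarrow> real \<Rightarrow> bool" where
  "smallest_zero h R t \<longleftrightarrow>
     t \<in> {0<..<R} \<and> h t = 0 \<and> (\<forall>s\<in>{0<..<R}. h s = 0 \<longrightarrow> t \<le> s)"

definition majorizing_function ::
    "'a::real_normed_vector set \<Rightarrow> ('a \<Rightarrow> 'b::real_normed_vector) \<Rightarrow>
     ('a \<Rightarrow> 'a \<Rightarrow>\<^sub>L 'b) \<Rightarrow> ('a \<Rightarrow> 'a \<Rightarrow>\<^sub>L 'a \<Rightarrow>\<^sub>L 'b) \<Rightarrow> 'a \<Rightarrow> real \<Rightarrow>
     (real \<Rightarrow> real) \<Rightarrow> (real \<Rightarrow> real) \<Rightarrow> (real \<Rightarrow> real) \<Rightarrow> bool" where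
  "majorizing_function D F F' F'' x0 R h h' h'' \<longleftrightarrow>
     R > 0 \<and> boundedly_invertible (F' x0) \<and>
     twice_cont_real_diff_on {0..<R} h h' h'' \<and>
     ball x0 R \<subseteq> D \<and>
     (\<forall>x\<in>ball x0 R. \<forall>y\<in>ball x0 R. norm (y - x) + norm (x - x0) < R \<longrightarrow>
        norm (compose_bilinear (inv_blinfun (F' x0)) (F'' y - F'' x))
          \<le> h'' (norm (y - x) + norm (x - x0)) - h'' (norm (x - x0))) \<and>
     norm (blinfun_apply (inv_blinfun (F' x0)) (F x0)) \<le> h 0 \<and>
     norm (compose_bilinear (inv_blinfun (F' x0)) (F'' x0)) \<le> h'' 0 \<and>
     h 0 > 0 \<and> h'' 0 > 0 \<and> h' 0 = -1 \<and>
     convex_on {0..<R} h'' \<and> strict_mono_on {0..<R} h'' \<and>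
     (\<exists>t. smallest_zero h R t \<and> h' t < 0)"

definition halley_op ::
    "('a::real_normed_vector \<Rightarrow> 'b::real_normed_vector) \<Rightarrow>
     ('a \<Rightarrow> 'a \<Rightarrow>\<^sub>L 'b) \<Rightarrow> ('a \<Rightarrow> 'a \<Rightarrow>\<^sub>L 'a \<Rightarrow>\<^sub>L 'b) \<Rightarrow> 'a \<Rightarrow> 'a \<Rightarrow>\<^sub>L 'a" where
  "halley_op F F' F'' x =
     (1/2) *\<^sub>R (inv_blinfun (F' x) o\<^sub>L
       blinfun_apply (F'' x) (blinfun_apply (inv_blinfun (F' x)) (F x)))"

primrec halley_seq ::
    "('a::real_normed_vector \<Rightarrow> 'b::real_normed_vector) \<Rightarrow>
     ('a \<Rightarrow> 'a \<Rightarrow>\<^sub>L 'b) \<Rightarrow> ('a \<Rightarrow> 'a \<Rightarrow>\<^sub>L 'a \<Rightarrow>\<^sub>L 'b) \<Rightarrow> 'a \<Rightarrow> nat \<Rightarrow> 'a" where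
  "halley_seq F F' F'' x0 0 = x0"
| "halley_seq F F' F'' x0 (Suc k) =
     (let x = halley_seq F F' F'' x0 k in
      x - blinfun_apply (inv_blinfun (id_blinfun - halley_op F F' F'' x))
            (blinfun_apply (inv_blinfun (F' x)) (F x)))"

definition halley_op_real ::
    "(real \<Rightarrow> real) \<Rightarrow> (real \<Rightarrow> real) \<Rightarrow> (real \<Rightarrow> real) \<Rightarrow> real \<Rightarrow> real" where
  "halley_op_real h h' h'' t = h t * h'' t / (2 * (h' t)\<^sup>2)"

primrec halley_seq_real ::
    "(real \<Rightarrow> real) \<Rightarrow> (real \<Rightarrow> real) \<Rightarrow> (real \<Rightarrow> real) \<Rightarrow> nat \<Rightarrow> real" where
  "halley_seq_real h h' h'' 0 = 0"
| "halley_seq_real h h' h'' (Suc k) =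
     (let t = halley_seq_real h h' h'' k in
      t - 1 / (1 - halley_op_real h h' h'' t) * (h t / h' t))"

definition left_deriv :: "(real \<Rightarrow> real) \<Rightarrow> real \<Rightarrow> real" where
  "left_deriv g u0 = Lim (at_left u0) (\<lambda>u. (g u0 - g u) / (u0 - u))"

definition converges_Q_cubically :: "(nat \<Rightarrow> 'a::real_normed_vector) \<Rightarrow> 'a \<Rightarrow> bool" where
  "converges_Q_cubically x xs \<longleftrightarrow>
     x \<longlonglongrightarrow> xs \<and>
     (\<exists>c\<ge>0. \<exists>N. \<forall>n\<ge>N. norm (xs - x (Suc n)) \<le> c * norm (xs - x n) ^ 3)"

end

theory Submission
  imports Defs
begin

text \<open>
  Replacing \<open>F\<close> by \<open>G = F'(x0)\<^sup>-\<^sup>1 F\<close> does not change the Halley iterates, so we may assume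
  \<open>F'(x0) = I\<close>. By induction, \<open>\<parallel>x\<^sub>k - x\<^sub>0\<parallel> \<le> t\<^sub>k\<close> and \<open>\<parallel>G(x\<^sub>k)\<parallel> \<le> h(t\<^sub>k)\<close>: writing
  \<open>s = x\<^sub>k\<^sub>+\<^sub>1 - x\<^sub>k\<close>, one has \<open>G(x\<^sub>k\<^sub>+\<^sub>1) = G''(x\<^sub>k)(L s, s)/2 + r\<close> with \<open>r\<close> the second-order Taylor
  remainder, and the same identity holds for \<open>h\<close>, so that every factor is majorized. As
  \<open>h(t\<^sub>k) \<le> t\<^sub>k\<^sub>+\<^sub>1 - t\<^sub>k\<close>, the limit is a zero of \<open>G\<close>.

  For the error \<open>e = x* - x\<^sub>k\<close> let \<open>r\<close> now be the Taylor remainder from \<open>x\<^sub>k\<close> to \<open>x*\<close>,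
  \<open>A = G'(x\<^sub>k)\<^sup>-\<^sup>1\<close> and \<open>B = G''(x\<^sub>k)\<close>. Then
  \<open>(I - L)(x* - x\<^sub>k\<^sub>+\<^sub>1) = - A r - A B(w, e)/2\<close> with \<open>w = - A B(e, e)/2 - A r\<close>,
  and again the scalar iteration satisfies the same identity. Convexity of \<open>h''\<close> makes \<open>\<parallel>r\<parallel>\<close> at
  most \<open>(\<parallel>e\<parallel> / (t* - t\<^sub>k))\<^sup>3\<close> times the scalar remainder, which gives the first estimate. For the
  second, \<open>L\<^sub>h \<le> 1/4\<close> (the second-order Taylor polynomial of \<open>h\<close> at \<open>t\<close> is nonpositive at \<open>t*\<close>,
  hence has nonnegative discriminant) and the scalar remainder over a step \<open>d\<close> is at most
  \<open>d\<^sup>2 (h''(t*) - h''(t)) / 6\<close>.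
\<close>

section \<open>Comparison of second-order remainders\<close>

text \<open>The mean value inequality with a scalar majorant is applied twice: the bound on second
  derivatives passes to the first derivatives and then to the functions, since all initial values
  vanish.\<close>

lemma second_order_comparison:
  fixes f f' f'' :: "real \<Rightarrow> 'a::real_normed_vector" and g g' g'' :: "real \<Rightarrow> real"
  assumes f: "\<And>s. s \<in> {0..1} \<Longrightarrow> (f has_vector_derivative f' s) (at s within {0..1})"
    and f': "\<And>s. s \<in> {0..1} \<Longrightarrow> (f' has_vector_derivative f'' s) (at s within {0..1})"
    and g: "\<And>s. s \<in> {0..1} \<Longrightarrow> (g has_vector_derivative g' s) (at s within {0..1})"
    and g': "\<And>s. s \<in> {0..1} \<Longrightarrow> (g' has_vector_derivative g'' s) (at s within {0..1})"
    and init: "f 0 = 0" "f' 0 = 0" "g 0 = 0" "g' 0 = 0"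
    and bound: "\<And>s. s \<in> {0..1} \<Longrightarrow> norm (f'' s) \<le> g'' s"
  shows "norm (f 1) \<le> g 1"
proof -
  have comparison: "norm (u s) \<le> v s"
    if u: "\<And>s. s \<in> {0..1} \<Longrightarrow> (u has_vector_derivative u' s) (at s within {0..1})"
      and v: "\<And>s. s \<in> {0..1} \<Longrightarrow> (v has_vector_derivative v' s) (at s within {0..1})"
      and zero: "u 0 = 0" "v 0 = 0"
      and le: "\<And>s. s \<in> {0..1} \<Longrightarrow> norm (u' s) \<le> v' s"
      and s: "s \<in> {0..1}"
    for u u' :: "real \<Rightarrow> 'a" and v v' :: "real \<Rightarrow> real" and s
  proof (cases "s = 0")
    case False
    with s have "0 < s" by simp
    then have "norm (u s - u 0) \<le> v s - v 0"
    proof (rule differentiable_bound_general[where f' = u' and \<phi>' = v'])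
      have "continuous_on {0..1} u" "continuous_on {0..1} v"
        unfolding continuous_on_eq_continuous_within
        using has_vector_derivative_continuous[OF u] has_vector_derivative_continuous[OF v] by blast+
      then show "continuous_on {0..s} u" "continuous_on {0..s} v"
        using s by (auto elim!: continuous_on_subset)
      fix r assume "0 < r" "r < s"
      then have r: "at r within {0..1} = at r" "r \<in> {0..1}"
        using s by (auto intro!: at_within_interior)
      show "(u has_vector_derivative u' r) (at r)" "(v has_vector_derivative v' r) (at r)"
        using u[OF r(2)] v[OF r(2)] by (simp_all only: r(1))
      show "norm (u' r) \<le> v' r" by (rule le[OF r(2)])
    qed
    then show ?thesis by (simp add: zero)
  qed (simp add: zero)
  have "norm (f' s) \<le> g' s" if "s \<in> {0..1}" for s
    by (rule comparison[OF f' g' init(2,4) bound that]) auto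
  then show ?thesis
    by (intro comparison[OF f g init(1,3)]) auto
qed

section \<open>Inverses of operators near the identity\<close>

text \<open>The Banach lemma on inverses. The lower bound
  \<open>(1 - q) * norm v <= norm (A v)\<close> yields injectivity and the norm of the inverse;
  surjectivity comes from a contraction whose fixed points solve \<open>A v = y\<close>.\<close>

lemma boundedly_invertible_near_id:
  fixes A :: "'a::banach \<Rightarrow>\<^sub>L 'a"
  assumes "norm (A - id_blinfun) \<le> q" "q < 1"
  shows "boundedly_invertible A" "norm (inv_blinfun A) \<le> 1 / (1 - q)"
proof -
  have "0 \<le> q" using assms(1) norm_ge_zero order_trans by blast
  have lower: "(1 - q) * norm v \<le> norm (A v)" for v
  proof -
    have "norm v - norm (A v) \<le> norm (A v - v)"
      by (metis norm_minus_commute norm_triangle_ineq2)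
    also have "A v - v = (A - id_blinfun) v"
      by (simp add: blinfun.diff_left)
    also have "norm \<dots> \<le> q * norm v"
      using norm_blinfun[of "A - id_blinfun" v] mult_right_mono[OF assms(1) norm_ge_zero[of v]]
      by linarith
    finally show ?thesis by (simp add: algebra_simps)
  qed
  have "inj A"
  proof (rule injI)
    fix u v assume "A u = A v"
    then have "A (u - v) = 0" by (simp add: blinfun.diff_right)
    with lower[of "u - v"] \<open>q < 1\<close> have "norm (u - v) \<le> 0"
      by (simp add: mult_le_0_iff)
    then show "u = v" by simp
  qed
  have "surj A"
  proof (rule surjI)
    fix y
    have "\<exists>!v. y - (A - id_blinfun) v = v"
    proof (rule banach_fix_type[OF \<open>0 \<le> q\<close> \<open>q < 1\<close>], intro allI)
      fix u v
      have "dist (y - (A - id_blinfun) u) (y - (A - id_blinfun) v) = norm ((A - id_blinfun) (u - v))"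
        by (simp add: dist_norm blinfun.diff_right norm_minus_commute)
      also have "\<dots> \<le> q * norm (u - v)"
        using norm_blinfun[of "A - id_blinfun" "u - v"]
          mult_right_mono[OF assms(1) norm_ge_zero[of "u - v"]] by linarith
      finally show "dist (y - (A - id_blinfun) u) (y - (A - id_blinfun) v) \<le> q * dist u v"
        by (simp add: dist_norm)
    qed
    then have "\<exists>v. A v = y"
      by (auto simp: blinfun.diff_left algebra_simps)
    then show "A (SOME v. A v = y) = y" by (rule someI_ex)
  qed
  have bij: "bij A" using \<open>inj A\<close> \<open>surj A\<close> by (simp add: bij_def)
  have bound: "norm (inv A y) \<le> norm y * (1 / (1 - q))" for y
    using lower[of "inv A y"] \<open>q < 1\<close> surj_f_inv_f[OF \<open>surj A\<close>, of y]
    by (simp add: field_simps)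
  have bl: "bounded_linear (inv A)"
  proof (rule bounded_linear_intro)
    show "inv A (u + v) = inv A u + inv A v" for u v
      by (rule inv_f_eq[OF \<open>inj A\<close>]) (simp add: blinfun.add_right surj_f_inv_f[OF \<open>surj A\<close>])
    show "inv A (r *\<^sub>R v) = r *\<^sub>R inv A v" for r v
      by (rule inv_f_eq[OF \<open>inj A\<close>]) (simp add: blinfun.scaleR_right surj_f_inv_f[OF \<open>surj A\<close>])
  qed (rule bound)
  show "boundedly_invertible A" using bij bl by (simp add: boundedly_invertible_def)
  show "norm (inv_blinfun A) \<le> 1 / (1 - q)"
  proof (rule norm_blinfun_bound)
    show "norm (inv_blinfun A y) \<le> 1 / (1 - q) * norm y" for y
      using bound[of y] by (simp only: inv_blinfun_def bounded_linear_Blinfun_apply[OF bl] mult.commute)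
  qed (use \<open>q < 1\<close> in simp)
qed

section \<open>Increments and slopes of convex functions, derivatives along segments\<close>

text \<open>\<open>t + l * a\<close> is the convex combination of \<open>t\<close> and
  \<open>t + a\<close> with weight \<open>l\<close>. The factor \<open>l\<close> gained here later
  supplies the third power of the error ratio.\<close>

lemma convex_on_increment_scale:
  fixes g :: "real \<Rightarrow> real"
  assumes "convex_on {0..<R} g" "0 \<le> t" "0 \<le> a" "t + a < R" "0 \<le> l" "l \<le> 1"
  shows "g (t + l * a) - g t \<le> l * (g (t + a) - g t)"
proof -
  have "(1 - l) *\<^sub>R t + l *\<^sub>R (t + a) = t + l * a" by (simp add: algebra_simps)
  moreover have "g ((1 - l) *\<^sub>R t + l *\<^sub>R (t + a)) \<le> (1 - l) * g t + l * g (t + a)"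
    using assms by (intro convex_onD) auto
  ultimately have "g (t + l * a) \<le> (1 - l) * g t + l * g (t + a)" by metis
  also have "\<dots> = g t + l * (g (t + a) - g t)" by (simp add: algebra_simps)
  finally show ?thesis by linarith
qed

text \<open>Both \<open>t\<close> and \<open>r + a\<close> lie on the segment from \<open>r\<close>
  to \<open>t + a\<close>, with complementary weights \<open>l\<close> and \<open>1 - l\<close>; the
  two chord bounds are added. The segment degenerates only if \<open>t = r\<close> and
  \<open>a = 0\<close>.\<close>

lemma convex_on_increment_mono:
  fixes g :: "real \<Rightarrow> real"
  assumes g: "convex_on {0..<R} g" and "0 \<le> r" "r \<le> t" "0 \<le> a" "t + a < R"
  shows "g (r + a) - g r \<le> g (t + a) - g t"
proof (cases "t + a = r")
  case False
  define b where "b = t + a - r"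
  define l where "l = (t - r) / b"
  have b: "b > 0" "r + b = t + a" using assms False by (auto simp: b_def)
  have lb: "l * b = t - r" using b by (simp add: l_def)
  have l: "0 \<le> l" "l \<le> 1" using b assms by (auto simp: l_def b_def divide_simps)
  have "r + l * b = t" "r + (1 - l) * b = r + a"
    unfolding left_diff_distrib lb by (auto simp: b_def)
  then have "g t - g r \<le> l * (g (r + b) - g r)" "g (r + a) - g r \<le> (1 - l) * (g (r + b) - g r)"
    using convex_on_increment_scale[OF g, of r b l] convex_on_increment_scale[OF g, of r b "1 - l"]
      assms b l by simp_all
  then show ?thesis unfolding b(2) by (simp add: algebra_simps)
qed (use assms in auto)

lemma has_real_derivative_along_segment:
  fixes g :: "real \<Rightarrow> real"
  assumes "(g has_real_derivative D) (at (t + s * d) within {0..<R})"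
    and "0 \<le> t" "0 \<le> d" "t + d < R"
  shows "((\<lambda>s. g (t + s * d)) has_real_derivative D * d) (at s within {0..1})"
proof -
  have "(\<lambda>s. t + s * d) ` {0..1} \<subseteq> {0..<R}"
  proof
    fix r assume "r \<in> (\<lambda>s. t + s * d) ` {0..1}"
    then obtain u where "u \<in> {0..1}" "r = t + u * d" by blast
    then show "r \<in> {0..<R}" using assms(2-) mult_left_le_one_le[of d u] by auto
  qed
  then have "(g has_real_derivative D) (at (t + s * d) within (\<lambda>s. t + s * d) ` {0..1})"
    by (rule DERIV_subset[OF assms(1)])
  moreover have "((\<lambda>s. t + s * d) has_real_derivative d) (at s within {0..1})"
    by (auto intro!: derivative_eq_intros)
  ultimately show ?thesis
    using DERIV_image_chain[of g D "\<lambda>s. t + s * d" s "{0..1}" d] by (simp add: o_def)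
qed

lemma has_vector_derivative_along_line:
  assumes "(g has_derivative g') (at (x + s *\<^sub>R e))"
  shows "((\<lambda>s. g (x + s *\<^sub>R e)) has_vector_derivative g' e) (at s within S)"
proof -
  have "((\<lambda>s. x + s *\<^sub>R e) has_derivative (\<lambda>s. s *\<^sub>R e)) (at s within S)"
    by (auto intro!: derivative_eq_intros)
  from has_derivative_compose[OF this assms] show ?thesis
    by (simp add: has_vector_derivative_def linear_scale[OF has_derivative_linear[OF assms]])
qed

text \<open>The slopes \<open>q s\<close> are nondecreasing and bounded by the slope from
  \<open>c\<close> to a point beyond \<open>c\<close>, so their left limit exists and is their
  supremum; this is the value that \<open>Lim\<close> selects.\<close>

lemma convex_on_slope_le_left_deriv:
  fixes g :: "real \<Rightarrow> real"
  assumes g: "convex_on {a..<b} g" and "a \<le> u" "u < c" "c < b"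
  shows "(g c - g u) / (c - u) \<le> left_deriv g c"
proof -
  define q where "q s = (g c - g s) / (c - s)" for s
  have flip: "(g r - g s) / (r - s) = (g s - g r) / (s - r)" for r s
    by (metis minus_diff_eq minus_divide_divide)
  define v where "v = (c + b) / 2"
  have v: "c < v" "v < b" using assms by (auto simp: v_def)
  have mono: "q r \<le> q s" if "a \<le> r" "r \<le> s" "s < c" for r s
  proof (cases "r = s")
    case False
    then show ?thesis
      using convex_on_slope_le(2)[OF g, of r c s] that assms by (simp add: q_def flip[of c])
  qed simp
  have bound: "q s \<le> (g c - g v) / (c - v)" if "a \<le> s" "s < c" for s
    using convex_on_slope_le[OF g, of s v c] that assms v by (simp add: q_def flip[of c s])
  have lim: "(q \<longlongrightarrow> Sup (q ` {a..<c})) (at_left c)"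
  proof (rule order_tendstoI)
    have bdd: "bdd_above (q ` {a..<c})" using bound by (auto intro!: bdd_aboveI)
    fix y
    {
      assume "y < Sup (q ` {a..<c})"
      then obtain s where s: "s \<in> {a..<c}" "y < q s"
        using less_cSup_iff[OF _ bdd, of y] assms by auto
      then have "\<forall>\<^sub>F r in at_left c. r \<in> {s<..<c}"
        by (intro eventually_at_left_real) auto
      then show "\<forall>\<^sub>F r in at_left c. y < q r"
        by eventually_elim (use s mono in \<open>auto intro: less_le_trans\<close>)
    }
    assume y: "Sup (q ` {a..<c}) < y"
    have "\<forall>\<^sub>F r in at_left c. r \<in> {u<..<c}" using assms by (intro eventually_at_left_real)
    then show "\<forall>\<^sub>F r in at_left c. q r < y"
      by eventually_elim (rule le_less_trans[OF cSup_upper[OF _ bdd] y], use assms in auto)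
  qed
  have "left_deriv g c = Sup (q ` {a..<c})"
    using tendsto_Lim[OF _ lim] by (simp add: left_deriv_def q_def[abs_def])
  moreover have "q u \<le> Sup (q ` {a..<c})"
    using assms bound by (intro cSup_upper) (auto intro!: bdd_aboveI)
  ultimately show ?thesis by (simp add: q_def)
qed

section \<open>Halley's method for the majorant\<close>

locale scalar_majorant =
  fixes h h' h'' :: "real \<Rightarrow> real" and R ts :: real
  assumes h_deriv: "s \<in> {0..<R} \<Longrightarrow> (h has_real_derivative h' s) (at s within {0..<R})"
    and h'_deriv: "s \<in> {0..<R} \<Longrightarrow> (h' has_real_derivative h'' s) (at s within {0..<R})"
    and h''_convex: "convex_on {0..<R} h''"
    and h''_strict_mono: "strict_mono_on {0..<R} h''"
    and h_0: "h 0 > 0" and h'_0: "h' 0 = -1" and h''_0: "h'' 0 > 0"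
    and smallest_zero: "smallest_zero h R ts"
    and h'_ts: "h' ts < 0"
begin

section \<open>Signs and monotonicity of the majorant and its derivatives\<close>

lemma ts: "0 < ts" "ts < R" "h ts = 0"
  using smallest_zero by (auto simp: smallest_zero_def)

lemma h''_mono: "0 \<le> s \<Longrightarrow> s \<le> t \<Longrightarrow> t < R \<Longrightarrow> h'' s \<le> h'' t"
  using strict_mono_onD[OF h''_strict_mono, of s t] by (cases "s = t") auto

lemma h''_pos: "0 \<le> t \<Longrightarrow> t < R \<Longrightarrow> h'' t > 0"
  using h''_mono[of 0 t] h''_0 by simp

lemma h'_mono: assumes "0 \<le> s" "s \<le> t" "t < R" shows "h' s \<le> h' t"
proof (rule DERIV_nonneg_imp_increasing_open[OF \<open>s \<le> t\<close>])
  fix r assume r: "s < r" "r < t"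
  then have "at r within {0..<R} = at r" using assms by (intro at_within_interior) auto
  then show "\<exists>y. (h' has_real_derivative y) (at r) \<and> 0 \<le> y"
    using h'_deriv[of r] h''_pos[of r] r assms by (auto intro!: exI[of _ "h'' r"] less_imp_le)
next
  have "continuous_on {0..<R} h'" by (rule DERIV_continuous_on[OF h'_deriv])
  then show "continuous_on {s..t} h'" using assms by (elim continuous_on_subset) auto
qed

lemma h'_bounds: assumes "0 \<le> t" "t \<le> ts" shows "-1 \<le> h' t" "h' t \<le> h' ts" "h' t < 0"
  using h'_mono[of 0 t] h'_mono[of t ts] ts h'_0 h'_ts assms by auto

lemma h_pos: assumes "0 \<le> t" "t < ts" shows "h t > 0"
proof (rule ccontr)
  assume "\<not> h t > 0"
  have "continuous_on {0..<R} h" by (rule DERIV_continuous_on[OF h_deriv])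
  then have "continuous_on {0..t} h" using assms ts by (elim continuous_on_subset) auto
  with IVT2'[of h t 0 0] h_0 \<open>\<not> h t > 0\<close> assms
  obtain r where r: "0 \<le> r" "r \<le> t" "h r = 0" by auto
  then have "r \<noteq> 0" using h_0 by auto
  with r assms ts have "r \<in> {0<..<R}" by auto
  then show False using smallest_zero r assms by (auto simp: smallest_zero_def)
qed

section \<open>Second-order Taylor remainder of the majorant\<close>

definition taylor_rem :: "real \<Rightarrow> real \<Rightarrow> real" where
  "taylor_rem t d = h (t + d) - h t - h' t * d - h'' t * d\<^sup>2 / 2"

lemma taylor_rem_path:
  assumes "0 \<le> t" "0 \<le> d" "t + d < R" "s \<in> {0..1}"
  shows "((\<lambda>s. taylor_rem t (s * d)) has_vector_derivative d * (h' (t + s * d) - h' t - s * (h'' t * d)))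
      (at s within {0..1})" (is ?A)
    and "((\<lambda>s. d * (h' (t + s * d) - h' t - s * (h'' t * d))) has_vector_derivative
      d\<^sup>2 * (h'' (t + s * d) - h'' t)) (at s within {0..1})" (is ?B)
proof -
  have "t + s * d \<in> {0..<R}"
    using assms mult_left_le_one_le[of d s] by auto
  note D = has_real_derivative_along_segment[OF h_deriv[OF this] assms(1-3)]
    has_real_derivative_along_segment[OF h'_deriv[OF this] assms(1-3)]
  show ?A unfolding has_real_derivative_iff_has_vector_derivative[symmetric] taylor_rem_def
    by (rule DERIV_cong, (rule derivative_intros D)+) (simp_all add: field_simps power2_eq_square)
  show ?B unfolding has_real_derivative_iff_has_vector_derivative[symmetric]
    by (rule DERIV_cong, (rule derivative_intros D)+) (simp_all add: field_simps power2_eq_square)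
qed

lemma taylor_rem_0: "taylor_rem t 0 = 0"
  by (simp add: taylor_rem_def)

lemma taylor_rem_nonneg:
  assumes "0 \<le> t" "0 \<le> d" "t + d < R"
  shows "0 \<le> taylor_rem t d"
proof -
  have "norm (0::real) \<le> taylor_rem t (1 * d)"
  proof (rule second_order_comparison[where f = "\<lambda>_. 0" and f' = "\<lambda>_. 0" and f'' = "\<lambda>_. 0"
        and g = "\<lambda>s. taylor_rem t (s * d)", OF _ _ taylor_rem_path[OF assms]])
    fix s :: real assume "s \<in> {0..1}"
    then have "h'' t \<le> h'' (t + s * d)"
      using assms mult_left_le_one_le[of d s] by (intro h''_mono) auto
    then show "norm (0::real) \<le> d\<^sup>2 * (h'' (t + s * d) - h'' t)" by simp
  qed (auto simp: taylor_rem_0)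
  then show ?thesis by simp
qed

lemma taylor_rem_le:
  assumes "0 \<le> t" "0 \<le> d" "t + d < R"
  shows "taylor_rem t d \<le> d\<^sup>2 * (h'' (t + d) - h'' t) / 6"
proof -
  define c where "c = d\<^sup>2 * (h'' (t + d) - h'' t)"
  \<comment> \<open>Convexity puts \<open>h''\<close> below its chord, so the second derivative
    along the segment is at most \<open>s * c\<close>; integrating twice gives
    \<open>s ^ 3 * c / 6\<close>.\<close>
  have "norm (taylor_rem t (1 * d)) \<le> 1 ^ 3 * c / 6"
  proof (rule second_order_comparison[where f = "\<lambda>s. taylor_rem t (s * d)"
        and g = "\<lambda>s. s ^ 3 * c / 6" and g' = "\<lambda>s. s\<^sup>2 * c / 2" and g'' = "\<lambda>s. s * c",
        OF taylor_rem_path[OF assms]])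
    fix s :: real assume s: "s \<in> {0..1}"
    then have "h'' t \<le> h'' (t + s * d)"
      using assms mult_left_le_one_le[of d s] by (intro h''_mono) auto
    moreover have "h'' (t + s * d) - h'' t \<le> s * (h'' (t + d) - h'' t)"
      using s assms by (intro convex_on_increment_scale[OF h''_convex]) auto
    ultimately show "norm (d\<^sup>2 * (h'' (t + s * d) - h'' t)) \<le> s * c"
      unfolding c_def by (simp add: abs_mult mult.left_commute[of s] mult_left_mono)
  qed (auto simp: taylor_rem_0 has_real_derivative_iff_has_vector_derivative[symmetric]
      power2_eq_square power3_eq_cube intro!: derivative_eq_intros)
  then show ?thesis by (simp add: c_def)
qed

section \<open>One Halley step for the majorant\<close>

definition halley_step :: "real \<Rightarrow> real" where
  "halley_step t = t - 1 / (1 - halley_op_real h h' h'' t) * (h t / h' t)"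

context
  fixes t assumes t: "0 \<le> t" "t < ts"
begin

lemma halley_op_real_bounds: "0 \<le> halley_op_real h h' h'' t" "halley_op_real h h' h'' t \<le> 1 / 4"
proof -
  define d where "d = ts - t"
  note pos = h_pos[OF t] h'_bounds[of t] h''_pos[of t] ts
  show "0 \<le> halley_op_real h h' h'' t"
    using t pos by (simp add: halley_op_real_def)
  have "0 \<le> taylor_rem t d"
    using t ts by (intro taylor_rem_nonneg) (auto simp: d_def)
  then have le: "h t + h' t * d + h'' t * d\<^sup>2 / 2 \<le> 0"
    using ts by (simp add: taylor_rem_def d_def)
  \<comment> \<open>The squared derivative of the quadratic Taylor polynomial at \<open>d\<close> is
    its discriminant plus \<open>2 * h'' t\<close> times its value at \<open>d\<close>, and that
    value is nonpositive.\<close>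
  have "0 \<le> (h' t + h'' t * d)\<^sup>2" by simp
  also have "\<dots> = (h' t)\<^sup>2 - 2 * h'' t * h t + 2 * h'' t * (h t + h' t * d + h'' t * d\<^sup>2 / 2)"
    by (simp add: algebra_simps power2_eq_square)
  also have "\<dots> \<le> (h' t)\<^sup>2 - 2 * h'' t * h t"
    using mult_nonneg_nonpos[of "2 * h'' t", OF _ le] pos t by simp
  finally show "halley_op_real h h' h'' t \<le> 1 / 4"
    using pos t by (simp add: halley_op_real_def field_simps)
qed

lemma halley_step_diff:
  "halley_step t - t = 1 / (1 - halley_op_real h h' h'' t) * (h t / (- h' t))"
  by (simp add: halley_step_def)

text \<open>Both factors \<open>1 / (1 - halley_op_real h h' h'' t)\<close> and
  \<open>1 / (- h' t)\<close> are at least 1. This later forces the residuals of the operator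
  iteration to tend to 0.\<close>

lemma h_le_halley_step_diff: "h t \<le> halley_step t - t"
proof -
  have "1 * (h t * 1) \<le> 1 / (1 - halley_op_real h h' h'' t) * (h t * (1 / (- h' t)))"
    using halley_op_real_bounds h_pos[OF t] h'_bounds[of t] t
    by (intro mult_mono) (auto simp: divide_simps)
  then show ?thesis by (simp add: halley_step_diff)
qed

text \<open>The error is written with nonnegative terms only, so that a norm estimate can match it
  factor by factor; \<open>a\<close> and \<open>b\<close> will bound the inverse derivative and the
  second derivative of the operator. The inner bracket equals \<open>d - a * h t\<close>, the error
  of a Newton step.\<close>

lemma halley_error:
  defines "a \<equiv> 1 / (- h' t)" and "b \<equiv> h'' t" and "d \<equiv> ts - t"
  shows "ts - halley_step t = 1 / (1 - halley_op_real h h' h'' t) *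
    (a * taylor_rem t d + a * b * (a * b * d\<^sup>2 / 2 + a * taylor_rem t d) * d / 2)"
proof -
  define L where "L = halley_op_real h h' h'' t"
  have a: "a > 0" using h'_bounds[of t] t by (simp add: a_def)
  have h': "h' t = - 1 / a" by (simp add: a_def)
  have L: "L = h t * b * a\<^sup>2 / 2"
    using a by (simp add: L_def halley_op_real_def h' b_def field_simps)
  have h: "h t = d / a - b * d\<^sup>2 / 2 - taylor_rem t d"
    using ts by (simp add: taylor_rem_def d_def h' b_def)
  have "(1 - L) * d - a * h t =
     a * taylor_rem t d + a * b * (a * b * d\<^sup>2 / 2 + a * taylor_rem t d) * d / 2"
    unfolding L h using a by (simp add: field_simps power2_eq_square)
  moreover have "ts - halley_step t = 1 / (1 - L) * ((1 - L) * d - a * h t)"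
    using halley_op_real_bounds by (simp add: halley_step_def d_def h' L_def[symmetric] field_simps)
  ultimately show ?thesis by (simp add: L_def)
qed

lemma halley_step_less: "halley_step t < ts"
proof -
  have "0 \<le> taylor_rem t (ts - t)" using t ts by (intro taylor_rem_nonneg) auto
  moreover have "h' t < 0" "h'' t > 0" using h'_bounds[of t] h''_pos[of t] t ts by auto
  ultimately have "0 < ts - halley_step t"
    unfolding halley_error using t halley_op_real_bounds
    by (intro mult_pos_pos add_nonneg_pos divide_pos_pos add_pos_nonneg mult_nonneg_nonneg) auto
  then show ?thesis by simp
qed

lemma halley_step_bounds: "0 \<le> halley_step t" "t \<le> halley_step t"
  using h_le_halley_step_diff h_pos[OF t] t by auto

text \<open>The step solves \<open>(1 - L) * d = - h t / h' t\<close>; eliminating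
  \<open>h t / h' t\<close> leaves a quadratic term weighted by \<open>L\<close>, with all factors
  nonnegative.\<close>

lemma h_halley_step:
  defines "d \<equiv> halley_step t - t"
  shows "h (halley_step t) = h'' t * (halley_op_real h h' h'' t * d) * d / 2 + taylor_rem t d"
proof -
  define L where "L = halley_op_real h h' h'' t"
  have h': "h' t < 0" using h'_bounds[of t] t by simp
  have "(1 - L) * d = - h t / h' t"
    using halley_op_real_bounds by (simp add: d_def halley_step_diff L_def)
  then have 1: "h t + h' t * d = h' t * L * d" using h' by (simp add: field_simps)
  have 2: "h' t * L = h t * h'' t / h' t / 2"
    using h' by (simp add: L_def halley_op_real_def power2_eq_square)
  have 3: "h t / h' t = L * d - d" using 1 h' by (simp add: field_simps)
  \<comment> \<open>The contribution of \<open>- d\<close> cancels the quadratic Taylor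
    term.\<close>
  have "h' t * L * d = h'' t * d / 2 * (L * d - d)"
    unfolding 2 3[symmetric] by (simp add: ac_simps)
  then have "h t + h' t * d + h'' t * d\<^sup>2 / 2 = h'' t * (L * d) * d / 2"
    unfolding 1 by (simp add: field_simps power2_eq_square)
  then show ?thesis by (simp add: taylor_rem_def L_def[symmetric]) (simp add: d_def)
qed

end

lemma h''_slope_le: "0 \<le> t \<Longrightarrow> t < ts \<Longrightarrow> h'' ts - h'' t \<le> left_deriv h'' ts * (ts - t)"
  using convex_on_slope_le_left_deriv[OF h''_convex, of t ts] ts by (simp add: divide_simps)

lemma left_deriv_nonneg: "0 \<le> left_deriv h'' ts"
proof -
  have "0 \<le> left_deriv h'' ts * (ts - 0)"
    using h''_slope_le[of 0] h''_mono[of 0 ts] ts by simp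
  then show ?thesis using ts by (simp add: zero_le_mult_iff)
qed

text \<open>The remainder occurs twice in \<open>halley_error\<close>. Standing alone, it is bounded
  through the left derivative; inside the product, it is bounded by
  \<open>d\<^sup>2 * (b' - b) / 6\<close> and absorbed into the term with \<open>b'\<close>.\<close>

lemma halley_error_le:
  assumes t: "0 \<le> t" "t < ts"
  shows "ts - halley_step t \<le> (1/3 * ((h'' ts)\<^sup>2 / (h' ts)\<^sup>2) + 2/9 * (left_deriv h'' ts / (- h' ts))) * (ts - t) ^ 3"
proof -
  define a b d r where "a = 1 / (- h' t)" and "b = h'' t" and "d = ts - t" and "r = taylor_rem t d"
  define a' b' m where "a' = 1 / (- h' ts)" and "b' = h'' ts" and "m = left_deriv h'' ts"
  have a: "0 \<le> a" "a \<le> a'"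
    using h'_bounds[of t] h'_ts t frac_le[of 1 1 "- h' ts" "- h' t"] by (auto simp: a_def a'_def)
  have b: "0 \<le> b" "b \<le> b'"
    using h''_pos[of t] h''_mono[of t ts] t ts by (auto simp: b_def b'_def)
  have d: "0 \<le> d" using t by (simp add: d_def)
  have r: "0 \<le> r" "r \<le> d\<^sup>2 * (b' - b) / 6"
    using taylor_rem_nonneg[of t d] taylor_rem_le[of t d] t ts by (auto simp: r_def d_def b_def b'_def)
  have m: "b' - b \<le> m * d" "0 \<le> m"
    using h''_slope_le[OF t] left_deriv_nonneg by (auto simp: b_def b'_def m_def d_def)
  have "r \<le> d\<^sup>2 * (m * d) / 6"
    using r(2) mult_left_mono[OF m(1), of "d\<^sup>2"] by simp
  then have "a * r \<le> a' * (d\<^sup>2 * (m * d) / 6)"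
    using a r(1) by (intro mult_mono) auto
  then have 1: "a * r \<le> a' * m * d ^ 3 / 6" by (simp add: power2_eq_square power3_eq_cube algebra_simps)
  \<comment> \<open>The coefficient of \<open>b\<close> is \<open>1/2 - 1/6 = 1/3\<close>. The
    weights \<open>1/3\<close> and \<open>1/6\<close> add up to \<open>1/2\<close>, so raising
    \<open>b\<close> to \<open>b'\<close> leaves no trace of the remainder.\<close>
  have "b * (b * d\<^sup>2 / 2 + r) \<le> b * (d\<^sup>2 * (b / 3 + b' / 6))"
    using r(2) b(1) by (intro mult_left_mono) (simp_all add: algebra_simps)
  also have "\<dots> \<le> b' * (d\<^sup>2 * (b' / 2))"
    using b by (intro mult_mono) auto
  finally have "a\<^sup>2 * (b * (b * d\<^sup>2 / 2 + r)) \<le> a'\<^sup>2 * (b' * (d\<^sup>2 * (b' / 2)))"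
    by (rule mult_mono[OF power_mono[OF a(2,1)]]) (use b r in auto)
  then have "a\<^sup>2 * (b * (b * d\<^sup>2 / 2 + r)) * d / 2 \<le> a'\<^sup>2 * (b' * (d\<^sup>2 * (b' / 2))) * d / 2"
    using d by (intro divide_right_mono mult_right_mono) auto
  then have 2: "a * b * (a * b * d\<^sup>2 / 2 + a * r) * d / 2 \<le> a'\<^sup>2 * b'\<^sup>2 * d ^ 3 / 4"
    by (simp add: power2_eq_square power3_eq_cube algebra_simps)
  have "ts - halley_step t = 1 / (1 - halley_op_real h h' h'' t) *
      (a * r + a * b * (a * b * d\<^sup>2 / 2 + a * r) * d / 2)"
    using halley_error[OF t] by (simp add: a_def b_def d_def r_def)
  \<comment> \<open>The factor \<open>4/3\<close> comes from the bound \<open>1/4\<close> on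
    \<open>halley_op_real\<close>; it turns \<open>1/6\<close> and \<open>1/4\<close> into
    \<open>2/9\<close> and \<open>1/3\<close>.\<close>
  also have "\<dots> \<le> 4 / 3 * (a' * m * d ^ 3 / 6 + a'\<^sup>2 * b'\<^sup>2 * d ^ 3 / 4)"
  proof (rule mult_mono)
    show "1 / (1 - halley_op_real h h' h'' t) \<le> 4 / 3"
      using halley_op_real_bounds[OF t] by (simp add: divide_simps)
    show "0 \<le> a * r + a * b * (a * b * d\<^sup>2 / 2 + a * r) * d / 2"
      using a b d r by (intro add_nonneg_nonneg divide_nonneg_pos mult_nonneg_nonneg) auto
  qed (use 1 2 in linarith)+
  also have "\<dots> = (1/3 * (b'\<^sup>2 * a'\<^sup>2) + 2/9 * (m * a')) * d ^ 3"
    by (simp add: algebra_simps)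
  also have "\<dots> = (1/3 * ((h'' ts)\<^sup>2 / (h' ts)\<^sup>2) + 2/9 * (left_deriv h'' ts / (- h' ts))) * (ts - t) ^ 3"
    by (simp add: a'_def b'_def m_def d_def power_divide)
  finally show ?thesis .
qed

end

section \<open>Halley's method for a majorized operator\<close>

lemma blinfun_apply_inv_blinfun:
  assumes "boundedly_invertible A"
  shows "A (inv_blinfun A y) = y" "inv_blinfun A (A v) = v"
  using inv_blinfun_compose[OF assms] by (metis blinfun_apply_blinfun_compose blinfun_apply_id_blinfun)+

text \<open>After normalization the operator maps the space to itself, so its derivatives can be
  inverted by comparison with the identity.\<close>

locale operator_majorant = scalar_majorant +
  fixes G :: "'a::banach \<Rightarrow> 'a" and G' :: "'a \<Rightarrow> 'a \<Rightarrow>\<^sub>L 'a"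
    and G'' :: "'a \<Rightarrow> 'a \<Rightarrow>\<^sub>L 'a \<Rightarrow>\<^sub>L 'a" and x0 :: 'a
  assumes G_deriv: "x \<in> ball x0 R \<Longrightarrow> (G has_derivative G' x) (at x)"
    and G'_deriv: "x \<in> ball x0 R \<Longrightarrow> (G' has_derivative G'' x) (at x)"
    and G''_diff: "x \<in> ball x0 R \<Longrightarrow> y \<in> ball x0 R \<Longrightarrow> norm (y - x) + norm (x - x0) < R \<Longrightarrow>
      norm (G'' y - G'' x) \<le> h'' (norm (y - x) + norm (x - x0)) - h'' (norm (x - x0))"
    and G_x0: "norm (G x0) \<le> h 0" and G'_x0: "G' x0 = id_blinfun" and G''_x0: "norm (G'' x0) \<le> h'' 0"
begin

section \<open>Taylor expansion of the operator\<close>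

text \<open>The majorant condition gives an increment of \<open>h''\<close> starting at
  \<open>norm (x - x0)\<close>. Growing increments move its start to \<open>t\<close>, and
  shortening \<open>s * d\<close> to \<open>s * norm e\<close> gains the factor
  \<open>norm e / d\<close>.\<close>

lemma G''_diff_le:
  assumes "norm (x - x0) \<le> t" "norm e \<le> d" "0 < d" "t + d < R" "s \<in> {0..1}"
  shows "x + s *\<^sub>R e \<in> ball x0 R"
    and "norm (G'' (x + s *\<^sub>R e) - G'' x) \<le> norm e / d * (h'' (t + s * d) - h'' t)"
proof -
  have s: "0 \<le> s" "s \<le> 1" "s * norm e \<le> norm e" "s * d \<le> d" "0 \<le> s * d" "0 \<le> s * norm e"
    using assms mult_left_le_one_le[of "norm e" s] mult_left_le_one_le[of d s] by auto
  have t: "0 \<le> t" using assms(1) norm_ge_zero order_trans by blast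
  have l: "0 \<le> norm e / d" "norm e / d \<le> 1" using assms by (auto simp: divide_simps)
  have "norm (x + s *\<^sub>R e - x0) \<le> norm (x - x0) + norm (s *\<^sub>R e)"
    by (metis add_diff_eq add.commute norm_triangle_ineq diff_add_eq)
  then have "norm (x + s *\<^sub>R e - x0) < R" using s assms by simp
  then show 1: "x + s *\<^sub>R e \<in> ball x0 R" by (simp add: dist_norm norm_minus_commute)
  have 2: "x \<in> ball x0 R" using assms by (simp add: dist_norm norm_minus_commute)
  have "norm (G'' (x + s *\<^sub>R e) - G'' x) \<le> h'' (norm (x - x0) + s * norm e) - h'' (norm (x - x0))"
    using G''_diff[OF 2 1] s assms by (simp add: add.commute)
  also have "\<dots> \<le> h'' (t + s * norm e) - h'' t"
    using s assms by (intro convex_on_increment_mono[OF h''_convex]) auto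
  also have "s * norm e = norm e / d * (s * d)" using assms by simp
  also have "h'' (t + norm e / d * (s * d)) - h'' t \<le> norm e / d * (h'' (t + s * d) - h'' t)"
    using s t l assms by (intro convex_on_increment_scale[OF h''_convex]) linarith+
  finally show "norm (G'' (x + s *\<^sub>R e) - G'' x) \<le> norm e / d * (h'' (t + s * d) - h'' t)" .
qed

text \<open>Two powers of \<open>norm e / d\<close> come from the two arguments of
  \<open>G''\<close> in the second derivative along the segment, the third from
  \<open>G''_diff_le\<close>.\<close>

lemma taylor_bound:
  assumes "norm (x - x0) \<le> t" "norm e \<le> d" "0 < d" "t + d < R"
  shows "norm (G (x + e) - G x - G' x e - (1/2) *\<^sub>R G'' x e e) \<le> (norm e / d) ^ 3 * taylor_rem t d"
proof -
  have t: "0 \<le> t" using assms(1) norm_ge_zero order_trans by blast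
  define f where "f s = G (x + s *\<^sub>R e) - G x - s *\<^sub>R G' x e - (s\<^sup>2 / 2) *\<^sub>R G'' x e e" for s
  define f' where "f' s = G' (x + s *\<^sub>R e) e - G' x e - s *\<^sub>R G'' x e e" for s
  define f'' where "f'' s = G'' (x + s *\<^sub>R e) e e - G'' x e e" for s
  let ?c = "(norm e / d) ^ 3"
  note path = taylor_rem_path[OF t less_imp_le[OF \<open>0 < d\<close>] \<open>t + d < R\<close>]
  have "norm (f 1) \<le> ?c * taylor_rem t (1 * d)"
  proof (rule second_order_comparison[where f' = f' and f'' = f'',
        OF _ _ has_vector_derivative_mult_right[OF path(1)] has_vector_derivative_mult_right[OF path(2)]])
    fix s :: real assume s: "s \<in> {0..1}"
    note ball = G''_diff_le(1)[OF assms s]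
    show "(f has_vector_derivative f' s) (at s within {0..1})"
      unfolding f_def f'_def
      by (auto intro!: derivative_eq_intros has_vector_derivative_along_line[OF G_deriv[OF ball]]
          simp: has_real_derivative_iff_has_vector_derivative[symmetric])
    show "(f' has_vector_derivative f'' s) (at s within {0..1})"
      unfolding f''_def f'_def
      by (auto intro!: derivative_eq_intros
          bounded_linear.has_vector_derivative[OF blinfun.bounded_linear_left]
          has_vector_derivative_along_line[OF G'_deriv[OF ball]])
    have "norm (f'' s) = norm ((G'' (x + s *\<^sub>R e) - G'' x) e e)"
      by (simp add: f''_def blinfun.diff_left)
    also have "\<dots> \<le> norm (G'' (x + s *\<^sub>R e) - G'' x) * norm e * norm e"
      by (meson mult_right_mono norm_blinfun norm_ge_zero order_trans)
    also have "\<dots> \<le> norm e / d * (h'' (t + s * d) - h'' t) * norm e * norm e"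
      by (intro mult_right_mono G''_diff_le(2) assms s) auto
    also have "\<dots> = ?c * (d\<^sup>2 * (h'' (t + s * d) - h'' t))"
      using \<open>0 < d\<close> by (simp add: power2_eq_square power3_eq_cube)
    finally show "norm (f'' s) \<le> \<dots>" .
  qed (auto simp: f_def f'_def taylor_rem_0)
  then show ?thesis by (simp add: f_def)
qed

section \<open>Bounds on the derivatives of the operator\<close>

lemma G''_bound:
  assumes "norm (x - x0) \<le> t" "t < R"
  shows "norm (G'' x) \<le> h'' t"
proof -
  have "x \<in> ball x0 R" "x0 \<in> ball x0 R" using assms le_less_trans[OF norm_ge_zero[of "x - x0"]]
    by (auto simp: dist_norm norm_minus_commute)
  then have "norm (G'' x - G'' x0) \<le> h'' (norm (x - x0)) - h'' 0"
    using G''_diff[of x0 x] by (simp add: dist_norm norm_minus_commute)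
  moreover have "h'' (norm (x - x0)) \<le> h'' t" using assms by (intro h''_mono) auto
  ultimately show ?thesis using G''_x0 norm_triangle_sub[of "G'' x" "G'' x0"] by linarith
qed

text \<open>Since \<open>G''\<close> is bounded by \<open>h''\<close>, the mean value inequality
  along the segment from \<open>x0\<close> compares \<open>G'\<close> with \<open>h'\<close>; the
  constant 1 is \<open>- h' 0\<close>.\<close>

lemma G'_near_id:
  assumes "norm (x - x0) \<le> t" "t < R"
  shows "norm (G' x - id_blinfun) \<le> 1 + h' t"
proof -
  define e where "e = x - x0"
  have e: "norm e < R" "0 \<le> norm e" using assms by (auto simp: e_def)
  have "norm (G' (x0 + 1 *\<^sub>R e) - G' (x0 + 0 *\<^sub>R e)) \<le> h' (0 + 1 * norm e) - h' (0 + 0 * norm e)"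
  proof (rule differentiable_bound_general)
    have *: "((\<lambda>s. G' (x0 + s *\<^sub>R e)) has_vector_derivative G'' (x0 + s *\<^sub>R e) e) (at s within {0..1})"
      and **: "((\<lambda>s. h' (0 + s * norm e)) has_vector_derivative h'' (0 + s * norm e) * norm e) (at s within {0..1})"
      and ***: "norm (G'' (x0 + s *\<^sub>R e) e) \<le> h'' (0 + s * norm e) * norm e"
      if "s \<in> {0..1}" for s
    proof -
      have le: "s * norm e \<le> norm e" "0 \<le> s" using that mult_left_le_one_le[of "norm e" s] by auto
      then have lt: "s * norm e < R" using e by simp
      show "((\<lambda>s. G' (x0 + s *\<^sub>R e)) has_vector_derivative G'' (x0 + s *\<^sub>R e) e) (at s within {0..1})"
        using lt le by (intro has_vector_derivative_along_line G'_deriv) (simp add: dist_norm)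
      show "((\<lambda>s. h' (0 + s * norm e)) has_vector_derivative h'' (0 + s * norm e) * norm e) (at s within {0..1})"
        unfolding has_real_derivative_iff_has_vector_derivative[symmetric]
        using lt le e by (intro has_real_derivative_along_segment[where R = R] h'_deriv) auto
      have "norm (G'' (x0 + s *\<^sub>R e)) \<le> h'' (0 + s * norm e)"
        using lt le by (intro G''_bound) auto
      then show "norm (G'' (x0 + s *\<^sub>R e) e) \<le> h'' (0 + s * norm e) * norm e"
        by (meson mult_right_mono norm_blinfun norm_ge_zero order_trans)
    qed
    show "continuous_on {0..1} (\<lambda>s. G' (x0 + s *\<^sub>R e))" "continuous_on {0..1} (\<lambda>s. h' (0 + s * norm e))"
      unfolding continuous_on_eq_continuous_within
      using has_vector_derivative_continuous[OF *] has_vector_derivative_continuous[OF **] by blast+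
    fix s :: real assume "0 < s" "s < 1"
    then have s: "at s within {0..1} = at s" "s \<in> {0..1}" by (auto intro!: at_within_interior)
    show "((\<lambda>s. G' (x0 + s *\<^sub>R e)) has_vector_derivative G'' (x0 + s *\<^sub>R e) e) (at s)"
      "((\<lambda>s. h' (0 + s * norm e)) has_vector_derivative h'' (0 + s * norm e) * norm e) (at s)"
      "norm (G'' (x0 + s *\<^sub>R e) e) \<le> h'' (0 + s * norm e) * norm e"
      using *[OF s(2)] **[OF s(2)] ***[OF s(2)] by (simp_all only: s(1))
  qed simp
  then have "norm (G' x - id_blinfun) \<le> h' (norm (x - x0)) - h' 0"
    by (simp add: e_def G'_x0)
  also have "\<dots> \<le> 1 + h' t" using h'_mono[of "norm (x - x0)" t] assms h'_0 by simp
  finally show ?thesis .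
qed

lemma G'_invertible:
  assumes "norm (x - x0) \<le> t" "t < ts"
  shows "boundedly_invertible (G' x)" "norm (inv_blinfun (G' x)) \<le> 1 / (- h' t)"
proof -
  have "0 \<le> t" using assms(1) norm_ge_zero order_trans by blast
  then have "norm (G' x - id_blinfun) \<le> 1 + h' t" "1 + h' t < 1"
    using assms ts h'_bounds[of t] by (auto intro!: G'_near_id)
  from boundedly_invertible_near_id[OF this]
  show "boundedly_invertible (G' x)" "norm (inv_blinfun (G' x)) \<le> 1 / (- h' t)" by simp_all
qed


section \<open>One Halley step for the operator\<close>

definition op_step :: "'a \<Rightarrow> 'a" where
  "op_step x = x - inv_blinfun (id_blinfun - halley_op G G' G'' x) (inv_blinfun (G' x) (G x))"

text \<open>A single step is studied at any point whose distance from \<open>x0\<close> and whose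
  residual are majorized at \<open>t\<close>; these are the invariants of the iteration.\<close>

context
  fixes x t assumes t: "norm (x - x0) \<le> t" "t < ts" and G_x: "norm (G x) \<le> h t"
begin

lemma t_nonneg: "0 \<le> t"
  using t(1) norm_ge_zero order_trans by blast

lemma newton_bound: "norm (inv_blinfun (G' x) (G x)) \<le> h t / (- h' t)"
proof -
  have "norm (inv_blinfun (G' x) (G x)) \<le> norm (inv_blinfun (G' x)) * norm (G x)"
    by (rule norm_blinfun)
  also have "\<dots> \<le> 1 / (- h' t) * h t"
    using G'_invertible(2)[OF t] G_x h'_bounds[of t] t_nonneg t by (intro mult_mono) auto
  finally show ?thesis by simp
qed

lemma inv_G''_bound: "norm (inv_blinfun (G' x) (G'' x v w)) \<le> h'' t / (- h' t) * norm v * norm w"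
proof -
  have "norm (G'' x v w) \<le> norm (G'' x) * norm v * norm w"
    by (meson mult_right_mono norm_blinfun norm_ge_zero order_trans)
  also have "\<dots> \<le> h'' t * norm v * norm w"
    using t ts by (intro mult_right_mono G''_bound) auto
  finally have 1: "norm (G'' x v w) \<le> h'' t * norm v * norm w" .
  have "norm (inv_blinfun (G' x) (G'' x v w)) \<le> norm (inv_blinfun (G' x)) * norm (G'' x v w)"
    by (rule norm_blinfun)
  also have "\<dots> \<le> 1 / (- h' t) * (h'' t * norm v * norm w)"
    using G'_invertible(2)[OF t] 1 h'_bounds[of t] t_nonneg t by (intro mult_mono) auto
  finally show ?thesis by simp
qed

lemma halley_op_apply:
  "halley_op G G' G'' x v = (1/2) *\<^sub>R inv_blinfun (G' x) (G'' x (inv_blinfun (G' x) (G x)) v)"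
  by (simp add: halley_op_def blinfun.scaleR_left)

lemma halley_op_bound: "norm (halley_op G G' G'' x) \<le> halley_op_real h h' h'' t"
proof (rule norm_blinfun_bound)
  show "0 \<le> halley_op_real h h' h'' t" using halley_op_real_bounds[OF t_nonneg t(2)] by simp
  fix v
  have h: "0 \<le> h'' t / (- h' t)"
    using h''_pos[of t] h'_bounds[of t] t t_nonneg ts by (intro divide_nonneg_nonneg) auto
  have "norm (halley_op G G' G'' x v) \<le> 1/2 * (h'' t / (- h' t) * norm (inv_blinfun (G' x) (G x)) * norm v)"
    using inv_G''_bound[of "inv_blinfun (G' x) (G x)" v] by (simp add: halley_op_apply)
  also have "\<dots> \<le> 1/2 * (h'' t / (- h' t) * (h t / (- h' t)) * norm v)"
    using h newton_bound by (intro mult_left_mono mult_right_mono) auto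
  also have "\<dots> = halley_op_real h h' h'' t * norm v"
    by (simp add: halley_op_real_def power2_eq_square mult.commute)
  finally show "norm (halley_op G G' G'' x v) \<le> halley_op_real h h' h'' t * norm v" .
qed

lemma id_minus_halley_op:
  shows "boundedly_invertible (id_blinfun - halley_op G G' G'' x)"
    and "norm (inv_blinfun (id_blinfun - halley_op G G' G'' x)) \<le> 1 / (1 - halley_op_real h h' h'' t)"
proof -
  have "norm ((id_blinfun - halley_op G G' G'' x) - id_blinfun) \<le> halley_op_real h h' h'' t"
    "halley_op_real h h' h'' t < 1"
    using halley_op_bound halley_op_real_bounds[OF t_nonneg t(2)] by auto
  note boundedly_invertible_near_id[OF this]
  then show "boundedly_invertible (id_blinfun - halley_op G G' G'' x)"
    "norm (inv_blinfun (id_blinfun - halley_op G G' G'' x)) \<le> 1 / (1 - halley_op_real h h' h'' t)"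
    by simp_all
qed

lemma inv_apply:
  "inv_blinfun (G' x) (G' x v) = v" "G' x (inv_blinfun (G' x) v) = v"
  "inv_blinfun (id_blinfun - halley_op G G' G'' x) (v - halley_op G G' G'' x v) = v"
  "inv_blinfun (id_blinfun - halley_op G G' G'' x) v -
    halley_op G G' G'' x (inv_blinfun (id_blinfun - halley_op G G' G'' x) v) = v"
  using blinfun_apply_inv_blinfun[OF G'_invertible(1)[OF t]]
    blinfun_apply_inv_blinfun[OF id_minus_halley_op(1), of v]
  by (simp_all add: blinfun.diff_left)

lemma op_step_diff_le: "norm (op_step x - x) \<le> halley_step t - t"
proof -
  have "norm (op_step x - x) \<le> norm (inv_blinfun (id_blinfun - halley_op G G' G'' x)) * norm (inv_blinfun (G' x) (G x))"
    using norm_blinfun by (simp add: op_step_def)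
  also have "\<dots> \<le> 1 / (1 - halley_op_real h h' h'' t) * (h t / (- h' t))"
    using id_minus_halley_op(2) newton_bound halley_op_real_bounds[OF t_nonneg t(2)]
    by (intro mult_mono) auto
  finally show ?thesis using halley_step_diff[OF t_nonneg t(2)] by simp
qed

lemma op_step_near: "norm (op_step x - x0) \<le> halley_step t"
  using norm_triangle_ineq[of "op_step x - x" "x - x0"] op_step_diff_le t by simp

lemma G_op_step: "norm (G (op_step x)) \<le> h (halley_step t)"
proof -
  define s d where "s = op_step x - x" and "d = halley_step t - t"
  define u where "u = inv_blinfun (G' x) (G x)"
  define L where "L = halley_op G G' G'' x"
  define r where "r = G (x + s) - G x - G' x s - (1/2) *\<^sub>R G'' x s s"
  have t0: "0 \<le> t" by (rule t_nonneg)
  have d: "0 < d" "t + d < R" "norm s \<le> d"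
    using h_le_halley_step_diff[OF t0 t(2)] h_pos[OF t0 t(2)] halley_step_less[OF t0 t(2)] ts op_step_diff_le
    by (auto simp: d_def s_def)
  \<comment> \<open>The step solves this linear equation, with \<open>u\<close> the Newton
    correction. As \<open>L s = u + s\<close>, the term with \<open>u\<close> and the quadratic
    Taylor term combine into one term with \<open>L s\<close>.\<close>
  have "s - L s = - u"
    using inv_apply(4)[of u] by (simp add: s_def op_step_def L_def u_def blinfun.minus_right algebra_simps)
  then have Ls: "L s = u + s" by (simp add: algebra_simps)
  have "G' x (L s) = (1/2) *\<^sub>R G'' x u s"
    by (simp add: L_def halley_op_apply blinfun.scaleR_right inv_apply u_def)
  then have "G' x s = (1/2) *\<^sub>R G'' x u s - G x"
    unfolding Ls by (simp add: blinfun.add_right inv_apply u_def algebra_simps)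
  then have "G (x + s) = (1/2) *\<^sub>R G'' x (L s) s + r"
    unfolding r_def Ls by (simp add: blinfun.add_right blinfun.add_left scaleR_add_right)
  moreover have "norm (G'' x (L s) s) \<le> h'' t * (halley_op_real h h' h'' t * d) * d"
  proof -
    have "norm (G'' x (L s) s) \<le> norm (G'' x) * norm (L s) * norm s"
      by (meson mult_right_mono norm_blinfun norm_ge_zero order_trans)
    also have "\<dots> \<le> h'' t * (halley_op_real h h' h'' t * d) * d"
    proof (intro mult_mono)
      show "norm (G'' x) \<le> h'' t" using t ts by (intro G''_bound) auto
      have "norm (L s) \<le> norm L * norm s" by (rule norm_blinfun)
      also have "\<dots> \<le> halley_op_real h h' h'' t * d"
        using halley_op_bound halley_op_real_bounds[OF t0 t(2)] d by (intro mult_mono) (auto simp: L_def)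
      finally show "norm (L s) \<le> halley_op_real h h' h'' t * d" .
    qed (use d h''_pos[of t] t0 t ts halley_op_real_bounds[OF t0 t(2)] in auto)
    finally show ?thesis .
  qed
  moreover have "norm r \<le> taylor_rem t d"
  proof -
    have "norm r \<le> (norm s / d) ^ 3 * taylor_rem t d"
      unfolding r_def using d by (intro taylor_bound t) auto
    also have "\<dots> \<le> 1 ^ 3 * taylor_rem t d"
      using d t0 by (intro mult_right_mono power_mono taylor_rem_nonneg) auto
    finally show ?thesis by simp
  qed
  ultimately have "norm (G (x + s)) \<le> h'' t * (halley_op_real h h' h'' t * d) * d / 2 + taylor_rem t d"
    by (auto intro!: norm_triangle_le)
  then show ?thesis
    using h_halley_step[OF t0 t(2)] by (simp add: s_def d_def)
qed

text \<open>The identity behind \<open>halley_error\<close> is repeated with operators in place of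
  numbers. With \<open>q = norm e / d\<close>, the remainder scales as \<open>q ^ 3\<close>,
  \<open>w\<close> as \<open>q\<^sup>2\<close> and \<open>e\<close> as \<open>q\<close>, so a common
  factor \<open>q ^ 3\<close> comes out.\<close>

lemma op_step_error:
  assumes "G z = 0" "norm (z - x) \<le> ts - t"
  shows "norm (z - op_step x) \<le> (ts - halley_step t) * (norm (z - x) / (ts - t)) ^ 3"
proof -
  define e d q where "e = z - x" and "d = ts - t" and "q = norm e / d"
  define u where "u = inv_blinfun (G' x) (G x)"
  define L where "L = halley_op G G' G'' x"
  define r where "r = G (x + e) - G x - G' x e - (1/2) *\<^sub>R G'' x e e"
  define a b \<rho> where "a = 1 / (- h' t)" and "b = h'' t" and "\<rho> = taylor_rem t d"
  \<comment> \<open>This is \<open>z - (x - u)\<close>, the error of a Newton step.\<close>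
  define w where "w = e + u"
  have t0: "0 \<le> t" by (rule t_nonneg)
  have d: "0 < d" "t + d < R" "norm e \<le> d" "norm e = q * d" and q: "0 \<le> q" "q \<le> 1"
    using t ts assms by (auto simp: d_def e_def q_def)
  have a: "0 \<le> a" using h'_bounds[of t] t0 t by (auto simp: a_def)
  have b: "0 \<le> b" using h''_pos[of t] t0 t ts by (auto simp: b_def)
  have \<rho>: "0 \<le> \<rho>" unfolding \<rho>_def using t0 d by (intro taylor_rem_nonneg) auto
  have L: "0 < 1 - halley_op_real h h' h'' t" using halley_op_real_bounds[OF t0 t(2)] by simp
  have inv_G'': "norm (inv_blinfun (G' x) (G'' x v v')) \<le> a * b * norm v * norm v'" for v v'
    using inv_G''_bound[of v v'] by (simp add: a_def b_def)
  have "norm (inv_blinfun (G' x) r) \<le> norm (inv_blinfun (G' x)) * norm r"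
    by (rule norm_blinfun)
  also have "\<dots> \<le> a * (q ^ 3 * \<rho>)"
    using G'_invertible(2)[OF t] taylor_bound[OF t(1) d(3,1,2)] a
    by (intro mult_mono) (auto simp: a_def r_def q_def \<rho>_def)
  finally have r: "norm (inv_blinfun (G' x) r) \<le> a * (q ^ 3 * \<rho>)" .
  have "r = - G x - G' x e - (1/2) *\<^sub>R G'' x e e"
    using assms by (simp add: r_def e_def)
  then have Ar: "inv_blinfun (G' x) r = - w - (1/2) *\<^sub>R inv_blinfun (G' x) (G'' x e e)"
    by (simp add: blinfun.diff_right blinfun.minus_right blinfun.scaleR_right inv_apply u_def w_def)
  have "norm w = norm ((1/2) *\<^sub>R inv_blinfun (G' x) (G'' x e e) + inv_blinfun (G' x) r)"
    unfolding Ar by (simp add: norm_minus_commute)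
  also have "\<dots> \<le> a * b * (q * d) * (q * d) / 2 + a * (q ^ 3 * \<rho>)"
    using inv_G''[of e e] r d(4) by (intro norm_triangle_le add_mono) auto
  \<comment> \<open>Lowering \<open>q ^ 3\<close> to \<open>q ^ 2\<close>, possible as
    \<open>q <= 1\<close>, lets a common factor come out and leaves the inner bracket of
    \<open>halley_error\<close>.\<close>
  also have "\<dots> \<le> a * b * (q * d) * (q * d) / 2 + a * (q ^ 2 * \<rho>)"
    using a \<rho> q by (intro add_left_mono mult_left_mono mult_right_mono power_decreasing) auto
  also have "\<dots> = q\<^sup>2 * (a * b * d\<^sup>2 / 2 + a * \<rho>)"
    by (simp add: algebra_simps power2_eq_square)
  finally have w: "norm w \<le> q\<^sup>2 * (a * b * d\<^sup>2 / 2 + a * \<rho>)" .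
  have "z - op_step x = e + inv_blinfun (id_blinfun - L) u"
    by (simp add: op_step_def e_def u_def L_def)
  also have "\<dots> = inv_blinfun (id_blinfun - L) (e - L e + u)"
    using inv_apply(3)[of e] by (simp add: blinfun.add_right L_def)
  \<comment> \<open>Here \<open>u = w - e\<close>. The part with \<open>e\<close> in the first
    argument, together with \<open>e + u = w\<close>, makes up the remainder term \<open>Ar\<close>;
    only the part with \<open>w\<close> stays.\<close>
  also have "L e = (1/2) *\<^sub>R inv_blinfun (G' x) (G'' x (w - e) e)"
    by (simp add: L_def halley_op_apply w_def u_def)
  also have "e - \<dots> + u = - inv_blinfun (G' x) r - (1/2) *\<^sub>R inv_blinfun (G' x) (G'' x w e)"
    unfolding Ar
    by (simp add: blinfun.diff_left blinfun.diff_right blinfun.add_left blinfun.add_right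
        scaleR_diff_right scaleR_add_right w_def)
  finally have "norm (z - op_step x) \<le> norm (inv_blinfun (id_blinfun - L)) *
      norm (- inv_blinfun (G' x) r - (1/2) *\<^sub>R inv_blinfun (G' x) (G'' x w e))"
    by (simp only: norm_blinfun)
  also have "\<dots> \<le> 1 / (1 - halley_op_real h h' h'' t) *
      (a * (q ^ 3 * \<rho>) + a * b * (q\<^sup>2 * (a * b * d\<^sup>2 / 2 + a * \<rho>)) * (q * d) / 2)"
  proof (intro mult_mono)
    show "norm (inv_blinfun (id_blinfun - L)) \<le> 1 / (1 - halley_op_real h h' h'' t)"
      using id_minus_halley_op(2) by (simp add: L_def)
    have "norm (inv_blinfun (G' x) (G'' x w e)) \<le> a * b * norm w * (q * d)"
      using inv_G''[of w e] d by simp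
    also have "\<dots> \<le> a * b * (q\<^sup>2 * (a * b * d\<^sup>2 / 2 + a * \<rho>)) * (q * d)"
      using w a b q d by (intro mult_right_mono mult_left_mono) auto
    finally have *: "norm (inv_blinfun (G' x) (G'' x w e)) \<le> \<dots>" .
    have "norm (- inv_blinfun (G' x) r - (1/2) *\<^sub>R inv_blinfun (G' x) (G'' x w e)) \<le>
        norm (inv_blinfun (G' x) r) + norm (inv_blinfun (G' x) (G'' x w e)) / 2"
      using norm_triangle_ineq4[of "- inv_blinfun (G' x) r" "(1/2) *\<^sub>R inv_blinfun (G' x) (G'' x w e)"]
      by simp
    then show "norm (- inv_blinfun (G' x) r - (1/2) *\<^sub>R inv_blinfun (G' x) (G'' x w e)) \<le>
        a * (q ^ 3 * \<rho>) + a * b * (q\<^sup>2 * (a * b * d\<^sup>2 / 2 + a * \<rho>)) * (q * d) / 2"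
      using add_mono[OF r divide_right_mono[OF *, of 2]] by (rule order_trans) simp
  qed (use L in auto)
  also have "\<dots> = 1 / (1 - halley_op_real h h' h'' t) *
      (a * \<rho> + a * b * (a * b * d\<^sup>2 / 2 + a * \<rho>) * d / 2) * q ^ 3"
    by (simp add: algebra_simps power2_eq_square power3_eq_cube)
  also have "\<dots> = (ts - halley_step t) * q ^ 3"
    using halley_error[OF t0 t(2)] by (simp add: a_def b_def d_def \<rho>_def)
  finally show ?thesis by (simp add: q_def e_def d_def)
qed

end

section \<open>The two Halley sequences and their limits\<close>

lemma halley_seq_real_Suc: "halley_seq_real h h' h'' (Suc k) = halley_step (halley_seq_real h h' h'' k)"
  by (simp add: halley_step_def Let_def)

lemma halley_seq_Suc: "halley_seq G G' G'' x0 (Suc k) = op_step (halley_seq G G' G'' x0 k)"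
  by (simp add: op_step_def Let_def)

abbreviation "tk \<equiv> halley_seq_real h h' h''"
abbreviation "xk \<equiv> halley_seq G G' G'' x0"

lemma tk_bounds: "0 \<le> tk k \<and> tk k < ts"
proof (induction k)
  case (Suc k)
  then show ?case
    using halley_step_less halley_step_bounds by (simp add: halley_seq_real_Suc del: halley_seq_real.simps)
qed (simp add: ts)

text \<open>The two bounds are proved jointly: the distance at the next index depends on the
  residual at the current one.\<close>

lemma xk_bounds: "norm (xk k - x0) \<le> tk k \<and> norm (G (xk k)) \<le> h (tk k)"
proof (induction k)
  case (Suc k)
  then show ?case
    using op_step_near G_op_step tk_bounds
    by (simp add: halley_seq_real_Suc halley_seq_Suc del: halley_seq_real.simps halley_seq.simps)
qed (simp add: G_x0)

lemma xk_step: "norm (xk (Suc k) - xk k) \<le> tk (Suc k) - tk k"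
  using op_step_diff_le xk_bounds tk_bounds
  by (simp add: halley_seq_real_Suc halley_seq_Suc del: halley_seq_real.simps halley_seq.simps)

lemma xk_diff: "norm (xk (k + n) - xk k) \<le> tk (k + n) - tk k"
proof (induction n)
  case (Suc n)
  have "norm (xk (k + Suc n) - xk k) \<le> norm (xk (Suc (k + n)) - xk (k + n)) + norm (xk (k + n) - xk k)"
    using norm_triangle_ineq[of "xk (Suc (k + n)) - xk (k + n)" "xk (k + n) - xk k"] by simp
  then show ?case using Suc xk_step[of "k + n"]
    by (simp del: halley_seq_real.simps halley_seq.simps)
qed simp

lemma tk_convergent: "convergent tk"
proof -
  have "incseq tk"
    using order_trans[OF norm_ge_zero xk_step] by (intro incseq_SucI) (simp only: diff_ge_0_iff_ge)
  moreover have "bdd_above (range tk)"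
    using tk_bounds by (auto intro!: bdd_aboveI[of _ ts] less_imp_le)
  ultimately show ?thesis using LIMSEQ_incseq_SUP convergentI by blast
qed

text \<open>Increments of \<open>tk\<close> dominate those of \<open>xk\<close>, which is therefore
  Cauchy. The residual is at most \<open>h (tk k)\<close>, hence at most an increment of
  \<open>tk\<close>, and so vanishes in the limit.\<close>

lemma xk_lim: obtains z where "xk \<longlonglongrightarrow> z" "G z = 0" "\<And>k. norm (z - xk k) \<le> ts - tk k"
proof -
  have "Cauchy xk"
    unfolding Cauchy_altdef2
  proof (intro allI impI)
    fix \<epsilon> :: real assume "0 < \<epsilon>"
    obtain N where "\<forall>n\<ge>N. dist (tk n) (tk N) < \<epsilon>"
      using tk_convergent \<open>0 < \<epsilon>\<close> unfolding Cauchy_convergent_iff[symmetric] Cauchy_altdef2 by blast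
    then have "dist (xk n) (xk N) < \<epsilon>" if "N \<le> n" for n
      using xk_diff[of N "n - N"] that by (fastforce simp: dist_norm)
    then show "\<exists>N. \<forall>n\<ge>N. dist (xk n) (xk N) < \<epsilon>" by blast
  qed
  then obtain z where z: "xk \<longlonglongrightarrow> z"
    using Cauchy_convergent_iff convergent_def by blast
  have le: "norm (z - xk k) \<le> ts - tk k" for k
  proof (rule LIMSEQ_le_const2[where X = "\<lambda>n. norm (xk n - xk k)"])
    show "(\<lambda>n. norm (xk n - xk k)) \<longlonglongrightarrow> norm (z - xk k)"
      by (intro tendsto_intros z)
    have "norm (xk n - xk k) \<le> ts - tk k" if "k \<le> n" for n
      using xk_diff[of k "n - k"] tk_bounds[of n] that by simp
    then show "\<exists>N. \<forall>n\<ge>N. norm (xk n - xk k) \<le> ts - tk k" by blast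
  qed
  have "z \<in> ball x0 R"
    using le[of 0] ts by (simp add: dist_norm norm_minus_commute)
  then have "isCont G z" using G_deriv has_derivative_continuous by blast
  then have "(\<lambda>k. G (xk k)) \<longlonglongrightarrow> G z" using z isCont_tendsto_compose by blast
  moreover have "(\<lambda>k. G (xk k)) \<longlonglongrightarrow> 0"
  proof (rule Lim_null_comparison)
    show "\<forall>\<^sub>F k in sequentially. norm (G (xk k)) \<le> tk (Suc k) - tk k"
    proof (intro always_eventually allI)
      fix k
      show "norm (G (xk k)) \<le> tk (Suc k) - tk k"
        using xk_bounds[of k] h_le_halley_step_diff[of "tk k"] tk_bounds[of k]
        unfolding halley_seq_real_Suc by linarith
    qed
    obtain T where "tk \<longlonglongrightarrow> T" using tk_convergent convergent_def by blast
    then have "(\<lambda>k. tk (Suc k) - tk k) \<longlonglongrightarrow> T - T"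
      by (intro tendsto_diff LIMSEQ_Suc)
    then show "(\<lambda>k. tk (Suc k) - tk k) \<longlonglongrightarrow> 0" by simp
  qed
  ultimately have "G z = 0" using LIMSEQ_unique by blast
  then show ?thesis using that z le by blast
qed

lemma halley_seq_error:
  assumes "G z = 0" "\<And>k. norm (z - xk k) \<le> ts - tk k"
  shows "norm (z - xk (Suc k)) \<le> (ts - tk (Suc k)) * (norm (z - xk k) / (ts - tk k)) ^ 3"
    and "norm (z - xk (Suc k)) \<le> (1/3 * ((h'' ts)\<^sup>2 / (h' ts)\<^sup>2) + 2/9 * (left_deriv h'' ts / (- h' ts)))
      * norm (z - xk k) ^ 3"
proof -
  note tk = tk_bounds[of k]
  show *: "norm (z - xk (Suc k)) \<le> (ts - tk (Suc k)) * (norm (z - xk k) / (ts - tk k)) ^ 3"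
    unfolding halley_seq_Suc halley_seq_real_Suc
    using xk_bounds tk assms by (intro op_step_error) auto
  let ?C = "1/3 * ((h'' ts)\<^sup>2 / (h' ts)\<^sup>2) + 2/9 * (left_deriv h'' ts / (- h' ts))"
  note *
  \<comment> \<open>With the scalar cubic estimate inserted, the powers of \<open>ts - tk k\<close>
    cancel.\<close>
  also have "(ts - tk (Suc k)) * (norm (z - xk k) / (ts - tk k)) ^ 3 \<le>
      ?C * (ts - tk k) ^ 3 * (norm (z - xk k) / (ts - tk k)) ^ 3"
    unfolding halley_seq_real_Suc using tk by (intro mult_right_mono halley_error_le) auto
  also have "\<dots> = ?C * norm (z - xk k) ^ 3"
    using tk by (simp add: power_divide)
  finally show "norm (z - xk (Suc k)) \<le> ?C * norm (z - xk k) ^ 3" .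
qed

end

section \<open>Normalization at the starting point\<close>

lemma compose_bilinear_diff: "compose_bilinear A (S - T) = compose_bilinear A S - compose_bilinear A T"
  by (intro blinfun_eqI) (simp add: compose_bilinear_apply blinfun.diff_left blinfun.diff_right)

text \<open>The inverse of \<open>A\<close> is recovered from that of the normalized operator, whose
  invertibility is what comparison with the identity provides.\<close>

lemma inv_blinfun_left_compose:
  assumes B: "boundedly_invertible B" and BA: "boundedly_invertible (inv_blinfun B o\<^sub>L A)"
  shows "inv_blinfun A = inv_blinfun (inv_blinfun B o\<^sub>L A) o\<^sub>L inv_blinfun B"
proof (rule inv_blinfun_unique(2))
  show "inv_blinfun (inv_blinfun B o\<^sub>L A) o\<^sub>L inv_blinfun B o\<^sub>L A = id_blinfun"
    using blinfun_apply_inv_blinfun(2)[OF BA] by (intro blinfun_eqI) simp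
  have "inv_blinfun B (A (inv_blinfun (inv_blinfun B o\<^sub>L A) (inv_blinfun B y))) = inv_blinfun B y" for y
    using blinfun_apply_inv_blinfun(1)[OF BA] by simp
  then have "A (inv_blinfun (inv_blinfun B o\<^sub>L A) (inv_blinfun B y)) = y" for y
    by (metis blinfun_apply_inv_blinfun(1)[OF B])
  then show "A o\<^sub>L (inv_blinfun (inv_blinfun B o\<^sub>L A) o\<^sub>L inv_blinfun B) = id_blinfun"
    by (intro blinfun_eqI) simp
qed

lemma operator_majorant_normalized:
  fixes F :: "'a::banach \<Rightarrow> 'b::real_normed_vector"
  assumes F: "twice_cont_frechet_diff_on D F F' F''"
    and major: "majorizing_function D F F' F'' x0 R h h' h''"
    and ts: "smallest_zero h R ts"
  shows "operator_majorant h h' h'' R ts (\<lambda>x. inv_blinfun (F' x0) (F x))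
    (\<lambda>x. inv_blinfun (F' x0) o\<^sub>L F' x) (\<lambda>x. compose_bilinear (inv_blinfun (F' x0)) (F'' x)) x0"
proof
  note m = major[unfolded majorizing_function_def]
  have D: "x \<in> D" if "x \<in> ball x0 R" for x using m that by blast
  \<comment> \<open>The majorizing condition speaks of some smallest zero; smallest zeros are
    unique, so it is \<open>ts\<close>.\<close>
  obtain s where s: "smallest_zero h R s" "h' s < 0" using m by blast
  with ts have "s = ts" by (force simp: smallest_zero_def)
  with s show "h' ts < 0" by simp
  show "(h has_real_derivative h' s) (at s within {0..<R})"
    "(h' has_real_derivative h'' s) (at s within {0..<R})" if "s \<in> {0..<R}" for s
    using m that by (simp_all add: twice_cont_real_diff_on_def)
  show "convex_on {0..<R} h''" "strict_mono_on {0..<R} h''" "0 < h 0" "h' 0 = - 1" "0 < h'' 0"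
    "norm (inv_blinfun (F' x0) (F x0)) \<le> h 0"
    "norm (compose_bilinear (inv_blinfun (F' x0)) (F'' x0)) \<le> h'' 0"
    using m by simp_all
  show "inv_blinfun (F' x0) o\<^sub>L F' x0 = id_blinfun"
    using m by (intro inv_blinfun_compose) simp
  show "smallest_zero h R ts" by (rule ts)
  show "norm (compose_bilinear (inv_blinfun (F' x0)) (F'' y) - compose_bilinear (inv_blinfun (F' x0)) (F'' x))
      \<le> h'' (norm (y - x) + norm (x - x0)) - h'' (norm (x - x0))"
    if "x \<in> ball x0 R" "y \<in> ball x0 R" "norm (y - x) + norm (x - x0) < R" for x y
    using m that unfolding compose_bilinear_diff[symmetric] by blast
  fix x assume x: "x \<in> ball x0 R"
  have dF: "(F has_derivative F' x) (at x)" "(F' has_derivative F'' x) (at x)"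
    using F D[OF x] by (auto simp: twice_cont_frechet_diff_on_def)
  show "((\<lambda>x. inv_blinfun (F' x0) (F x)) has_derivative inv_blinfun (F' x0) o\<^sub>L F' x) (at x)"
    using bounded_linear.has_derivative[OF blinfun.bounded_linear_right dF(1)]
    by (simp add: blinfun_compose.rep_eq o_def)
  have "((\<lambda>x. inv_blinfun (F' x0) o\<^sub>L F' x) has_derivative (\<lambda>v. inv_blinfun (F' x0) o\<^sub>L F'' x v)) (at x)"
    by (rule bounded_linear.has_derivative[OF
          bounded_bilinear.bounded_linear_right[OF bounded_bilinear_blinfun_compose] dF(2)])
  also have "(\<lambda>v. inv_blinfun (F' x0) o\<^sub>L F'' x v) = compose_bilinear (inv_blinfun (F' x0)) (F'' x)"
    by (intro ext blinfun_eqI) (simp add: compose_bilinear_apply)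
  finally show "((\<lambda>x. inv_blinfun (F' x0) o\<^sub>L F' x) has_derivative
      compose_bilinear (inv_blinfun (F' x0)) (F'' x)) (at x)" .
qed

text \<open>The factor \<open>inv_blinfun (F' x0)\<close> cancels in the Newton correction and in
  the Halley operator. At each iterate this uses invertibility of the normalized derivative, hence
  the bounds \<open>xk_bounds\<close> and \<open>tk_bounds\<close>.\<close>

lemma halley_seq_normalized:
  fixes F :: "'a::banach \<Rightarrow> 'b::real_normed_vector"
  assumes F: "twice_cont_frechet_diff_on D F F' F''"
    and major: "majorizing_function D F F' F'' x0 R h h' h''"
    and ts: "smallest_zero h R ts"
  shows "halley_seq F F' F'' x0 = halley_seq (\<lambda>x. inv_blinfun (F' x0) (F x))
    (\<lambda>x. inv_blinfun (F' x0) o\<^sub>L F' x) (\<lambda>x. compose_bilinear (inv_blinfun (F' x0)) (F'' x)) x0"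
    (is "_ = halley_seq ?G ?G' ?G'' x0")
proof
  interpret operator_majorant h h' h'' R ts ?G ?G' ?G'' x0
    by (rule operator_majorant_normalized[OF assms])
  have B: "boundedly_invertible (F' x0)"
    using major by (simp add: majorizing_function_def)
  fix k
  show "halley_seq F F' F'' x0 k = halley_seq ?G ?G' ?G'' x0 k"
  proof (induction k)
    case (Suc k)
    let ?x = "halley_seq ?G ?G' ?G'' x0 k"
    have "boundedly_invertible (?G' ?x)"
      using G'_invertible(1) xk_bounds tk_bounds by blast
    note inv = inv_blinfun_left_compose[OF B this]
    have newton: "inv_blinfun (F' ?x) (F ?x) = inv_blinfun (?G' ?x) (?G ?x)"
      unfolding inv by simp
    then have "halley_op F F' F'' ?x = halley_op ?G ?G' ?G'' ?x"
      by (intro blinfun_eqI)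
        (simp add: halley_op_def blinfun.scaleR_left compose_bilinear_apply, simp add: inv)
    with newton Suc show ?case by (simp add: Let_def)
  qed simp
qed

theorem theorem3:
  fixes D :: "'a::banach set"
    and F :: "'a \<Rightarrow> 'b::banach"
    and F' :: "'a \<Rightarrow> 'a \<Rightarrow>\<^sub>L 'b"
    and F'' :: "'a \<Rightarrow> 'a \<Rightarrow>\<^sub>L 'a \<Rightarrow>\<^sub>L 'b"
    and x0 xstar :: 'a
    and h h' h'' :: "real \<Rightarrow> real"
    and R tstar :: real
    and x :: "nat \<Rightarrow> 'a"
    and t :: "nat \<Rightarrow> real"
  assumes "D \<noteq> {}" "open D" "convex D"
    and "twice_cont_frechet_diff_on D F F' F''"
    and "x0 \<in> D" "boundedly_invertible (F' x0)"
    and "R > 0" "majorizing_function D F F' F'' x0 R h h' h''"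
    and "smallest_zero h R tstar"
    and "x = halley_seq F F' F'' x0"
    and "xstar = lim x"
    and "t = halley_seq_real h h' h''"
  shows "(\<forall>k. norm (xstar - x (Suc k))
             \<le> (tstar - t (Suc k)) * (norm (xstar - x k) / (tstar - t k)) ^ 3) \<and>
         converges_Q_cubically x xstar \<and>
         (\<forall>k. norm (xstar - x (Suc k))
             \<le> (1/3 * ((h'' tstar)\<^sup>2 / (h' tstar)\<^sup>2) + 2/9 * (left_deriv h'' tstar / (- h' tstar)))
                * norm (xstar - x k) ^ 3)"
proof -
  let ?G = "\<lambda>x. inv_blinfun (F' x0) (F x)" and ?G' = "\<lambda>x. inv_blinfun (F' x0) o\<^sub>L F' x"
    and ?G'' = "\<lambda>x. compose_bilinear (inv_blinfun (F' x0)) (F'' x)"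
  let ?C = "1/3 * ((h'' tstar)\<^sup>2 / (h' tstar)\<^sup>2) + 2/9 * (left_deriv h'' tstar / (- h' tstar))"
  interpret operator_majorant h h' h'' R tstar ?G ?G' ?G'' x0
    by (rule operator_majorant_normalized[OF assms(4,8,9)])
  have x: "x = xk"
    using halley_seq_normalized[OF assms(4,8,9)] assms(10) by simp
  obtain z where z: "xk \<longlonglongrightarrow> z" "?G z = 0" "\<And>k. norm (z - xk k) \<le> tstar - tk k"
    using xk_lim by blast
  then have "xstar = z" using assms(11) x limI by blast
  have error: "norm (xstar - x (Suc k)) \<le> (tstar - t (Suc k)) * (norm (xstar - x k) / (tstar - t k)) ^ 3"
    "norm (xstar - x (Suc k)) \<le> ?C * norm (xstar - x k) ^ 3" for k
    unfolding \<open>xstar = z\<close> x assms(12) by (rule halley_seq_error[OF z(2,3)])+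
  have "0 \<le> ?C"
    using h'_ts left_deriv_nonneg by (intro add_nonneg_nonneg mult_nonneg_nonneg divide_nonneg_pos) auto
  then have "converges_Q_cubically x xstar"
    unfolding converges_Q_cubically_def using error(2) z(1) x \<open>xstar = z\<close> by blast
  with error show ?thesis by blast
qed

end
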